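(* Let $X$ be a Banach space and let $V\subseteq S(\mathbb K)$ be a BK-space such that $e_n\in V$ for all $n\in\mathbb N$. If $\nu_V<\infty$, then $M_\Sigma(V,X)$ is a BK-space. Furthermore, $$\frac1{\nu_V}\|f\|_{M'(V,\Sigma c(X))}\le\|f\|_{M_\Sigma(V,X)}\le\|f\|_{M'(V,\Sigma c(X))}\qquad\forall f\in M_\Sigma(V,X).$$ Therefore, if $\nu_V=1$, then $\|f\|_{M_\Sigma(V,X)}=\|f\|_{M'(V,\Sigma c(X))}$ for all $f\in M_\Sigma(V,X)$.
   Context: $\mathbb K=\mathbb R$ or $\mathbb C$. $S(X)$ is the vector space of all sequences in $X$ (functions $\mathbb N\to X$); $e_n\in S(\mathbb K)$ is the $n$-th canonical sequence. A BK-space in $S(X)$ is a vector subspace with a complete norm for which every coordinate map $s\mapsto s(n)$ into $X$ is continuous. For $V$ as in the claim, $\pi_n:V\to V$ is $\pi_n v=\sum_{k=1}^n v(k)e_k$ (a bounded operator), and $\nu_V:=\sup_n\|\pi_n\|\in[1,\infty]$. $\Sigma c(X)$ is the Banach space of sequences $s=\{x_n\}_n$ in $X$ such that $\sum_n x_n$ converges, with norm $\|s\|_{\Sigma c(X)}=\sup_n\|\sum_{k=1}^n x_k\|$. $M'(V,\Sigma c(X)):=\{f\in S(X): v\cdot f\in\Sigma c(X)\ \forall v\in V\}$, where $(v\cdot f)(n)=v(n)f(n)$, with norm $\|f\|_{M'(V,\Sigma c(X))}:=\sup\{\|v\cdot f\|_{\Sigma c(X)}:\|v\|_V\le1\}$.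 $M_\Sigma(V,X)$ is the same vector space as $M'(V,\Sigma c(X))$, equipped instead with the norm $\|f\|_{M_\Sigma(V,X)}:=\sup\{\|\sum_{n=1}^\infty v(n)f(n)\|:\|v\|_V\le1\}$. *)

theory Defs
  imports "HOL-Analysis.Analysis" "HOL-Library.Function_Algebras"
begin

text \<open>
  The scalar field is a type of class \<open>real_normed_field\<close>. By the Gelfand-Mazur
  theorem every such type is isometrically isomorphic to the reals or to the complex numbers, so
  this covers exactly these two cases.

  A Banach space over \<open>'k\<close> is a type of class \<open>banach\<close> with a \<open>'k\<close>-scalar multiplication for which
  the norm is homogeneous. The class only contributes addition, norm and completeness; that
  \<open>smul (of_real r)\<close> is the real scalar multiplication of the class is automatic, both being
  additive and continuous in \<open>r\<close>.
\<close>

locale banach_space_over = vector_space smul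
  for smul :: "'k::real_normed_field \<Rightarrow> 'x::banach \<Rightarrow> 'x" +
  assumes norm_smul: "norm (smul a x) = norm a * norm x"

text \<open>
  Sequences are indexed from 0, so the \<open>n\<close>-th partial sum is the one over \<open>{..n}\<close>. Addition,
  subtraction and zero of sequences are the pointwise ones of \<open>Function_Algebras\<close>.
\<close>

definition seq_scale :: "('k \<Rightarrow> 'x \<Rightarrow> 'x) \<Rightarrow> 'k \<Rightarrow> (nat \<Rightarrow> 'x) \<Rightarrow> nat \<Rightarrow> 'x" where
  "seq_scale smul a s = (\<lambda>n. smul a (s n))"

definition seq_mult :: "('k \<Rightarrow> 'x \<Rightarrow> 'x) \<Rightarrow> (nat \<Rightarrow> 'k) \<Rightarrow> (nat \<Rightarrow> 'x) \<Rightarrow> nat \<Rightarrow> 'x" where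
  "seq_mult smul v f = (\<lambda>n. smul (v n) (f n))"

definition unit_seq :: "nat \<Rightarrow> nat \<Rightarrow> 'k::zero_neq_one" where
  "unit_seq k = (\<lambda>n. if n = k then 1 else 0)"

text \<open>
  Only the values of \<open>N\<close> on \<open>V\<close> matter. The locale \<open>Metric_space\<close> wants a distance that is
  nonnegative and symmetric on the whole type, hence the value 0 off the carrier.
\<close>

definition norm_dist ::
  "(nat \<Rightarrow> 'x::ab_group_add) set \<Rightarrow> ((nat \<Rightarrow> 'x) \<Rightarrow> real) \<Rightarrow> (nat \<Rightarrow> 'x) \<Rightarrow> (nat \<Rightarrow> 'x) \<Rightarrow> real"
  where "norm_dist V N s t = (if s \<in> V \<and> t \<in> V then N (s - t) else 0)"

locale BK_space =
  fixes smul :: "'k::real_normed_field \<Rightarrow> 'x::real_normed_vector \<Rightarrow> 'x"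
    and V :: "(nat \<Rightarrow> 'x) set"
    and N :: "(nat \<Rightarrow> 'x) \<Rightarrow> real"
  assumes subspace: "module.subspace (seq_scale smul) V"
    and norm_nonneg: "s \<in> V \<Longrightarrow> 0 \<le> N s"
    and norm_eq_0_iff: "s \<in> V \<Longrightarrow> N s = 0 \<longleftrightarrow> s = 0"
    and norm_triangle: "s \<in> V \<Longrightarrow> t \<in> V \<Longrightarrow> N (s + t) \<le> N s + N t"
    and norm_seq_scale: "s \<in> V \<Longrightarrow> N (seq_scale smul a s) = norm a * N s"
    and complete: "Metric_space.mcomplete V (norm_dist V N)"
    and continuous_coordinate:
      "continuous_map (Metric_space.mtopology V (norm_dist V N)) euclidean (\<lambda>s. s n)"

text \<open>
  Suprema that are not known to be finite beforehand are taken in \<open>ennreal\<close>.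
\<close>

definition section_proj :: "nat \<Rightarrow> (nat \<Rightarrow> 'k) \<Rightarrow> nat \<Rightarrow> 'k::real_normed_field" where
  "section_proj n v = (\<Sum>k\<le>n. seq_scale (*) (v k) (unit_seq k))"

definition nu :: "(nat \<Rightarrow> 'k::real_normed_field) set \<Rightarrow> ((nat \<Rightarrow> 'k) \<Rightarrow> real) \<Rightarrow> ennreal" where
  "nu V N = (SUP n. SUP v \<in> {v \<in> V. N v \<le> 1}. ennreal (N (section_proj n v)))"

definition Sigma_c :: "(nat \<Rightarrow> 'x::banach) set" where
  "Sigma_c = {s. summable s}"

definition Sigma_c_norm :: "(nat \<Rightarrow> 'x::banach) \<Rightarrow> real" where
  "Sigma_c_norm s = (SUP n. norm (\<Sum>k\<le>n. s k))"

definition mult_space ::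
  "('k \<Rightarrow> 'x \<Rightarrow> 'x) \<Rightarrow> (nat \<Rightarrow> 'k) set \<Rightarrow> (nat \<Rightarrow> 'x) set \<Rightarrow> (nat \<Rightarrow> 'x) set" where
  "mult_space smul V W = {f. \<forall>v\<in>V. seq_mult smul v f \<in> W}"

definition mult_norm ::
  "('k \<Rightarrow> 'x \<Rightarrow> 'x) \<Rightarrow> (nat \<Rightarrow> 'k) set \<Rightarrow> ((nat \<Rightarrow> 'k) \<Rightarrow> real) \<Rightarrow> ((nat \<Rightarrow> 'x) \<Rightarrow> real)
    \<Rightarrow> (nat \<Rightarrow> 'x) \<Rightarrow> ennreal" where
  "mult_norm smul V N NW f = (SUP v \<in> {v \<in> V. N v \<le> 1}. ennreal (NW (seq_mult smul v f)))"

definition M_Sigma ::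
  "('k \<Rightarrow> 'x \<Rightarrow> 'x) \<Rightarrow> (nat \<Rightarrow> 'k) set \<Rightarrow> (nat \<Rightarrow> 'x::banach) set" where
  "M_Sigma smul V = mult_space smul V Sigma_c"

definition M_Sigma_norm ::
  "('k \<Rightarrow> 'x \<Rightarrow> 'x) \<Rightarrow> (nat \<Rightarrow> 'k) set \<Rightarrow> ((nat \<Rightarrow> 'k) \<Rightarrow> real) \<Rightarrow> (nat \<Rightarrow> 'x::banach) \<Rightarrow> ennreal"
  where
  "M_Sigma_norm smul V N f =
     (SUP v \<in> {v \<in> V. N v \<le> 1}. ennreal (norm (\<Sum>n. seq_mult smul v f n)))"

end

theory Submission
  imports Defs
begin

text \<open>
  Evaluating the series of \<open>\<pi>\<^sub>n v \<cdot> f\<close> gives the \<open>n\<close>-th partial sum of \<open>v \<cdot> f\<close>, so every partial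
  sum is controlled by \<open>\<nu>\<^sub>V\<close> times the norm of \<open>f\<close> in \<open>M\<^sub>\<Sigma>(V, X)\<close>. This is the norm comparison, and it
  also makes Cauchy sequences in \<open>M\<^sub>\<Sigma>(V, X)\<close> converge uniformly in all partial sums, whence
  completeness. That the norm is finite is the uniform boundedness principle on \<open>V\<close>.
\<close>

section \<open>Normed sequence spaces and the uniform boundedness principle\<close>

lemma module_seq_scale:
  assumes "vector_space smul"
  shows "module (seq_scale smul)"
proof -
  interpret vector_space smul by fact
  show ?thesis
    by unfold_locales
      (auto simp: seq_scale_def fun_eq_iff scale_right_distrib scale_left_distrib)
qed

text \<open>The purely normed part of a BK-space. Split off so that it can be instantiated for
  \<open>V\<close> and again for \<open>M_Sigma smul V\<close> before completeness of the latter is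
  known.\<close>

locale normed_sequence_space = vector_space smul
  for smul :: "'k::real_normed_field \<Rightarrow> 'x::ab_group_add \<Rightarrow> 'x" +
  fixes V :: "(nat \<Rightarrow> 'x) set" and N :: "(nat \<Rightarrow> 'x) \<Rightarrow> real"
  assumes seq_subspace: "module.subspace (seq_scale smul) V"
    and N_nonneg: "s \<in> V \<Longrightarrow> 0 \<le> N s"
    and N_eq_0_iff: "s \<in> V \<Longrightarrow> N s = 0 \<longleftrightarrow> s = 0"
    and N_triangle: "s \<in> V \<Longrightarrow> t \<in> V \<Longrightarrow> N (s + t) \<le> N s + N t"
    and N_scale: "s \<in> V \<Longrightarrow> N (seq_scale smul a s) = norm a * N s"
begin

lemma
  shows zero_mem: "0 \<in> V"
    and add_mem: "s \<in> V \<Longrightarrow> t \<in> V \<Longrightarrow> s + t \<in> V"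
    and scale_mem: "s \<in> V \<Longrightarrow> seq_scale smul a s \<in> V"
    and diff_mem: "s \<in> V \<Longrightarrow> t \<in> V \<Longrightarrow> s - t \<in> V"
    and sum_mem: "(\<And>i. i \<in> I \<Longrightarrow> g i \<in> V) \<Longrightarrow> sum g I \<in> V"
proof -
  interpret seq: module "seq_scale smul"
    by (rule module_seq_scale) unfold_locales
  show "0 \<in> V" "s \<in> V \<Longrightarrow> t \<in> V \<Longrightarrow> s + t \<in> V" "s \<in> V \<Longrightarrow> seq_scale smul a s \<in> V"
    "s \<in> V \<Longrightarrow> t \<in> V \<Longrightarrow> s - t \<in> V" "(\<And>i. i \<in> I \<Longrightarrow> g i \<in> V) \<Longrightarrow> sum g I \<in> V"
    using seq_subspace
    by (blast intro: seq.subspace_0 seq.subspace_add seq.subspace_scale seq.subspace_diff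
        seq.subspace_sum)+
qed

lemma N_zero: "N 0 = 0"
  using N_eq_0_iff zero_mem by simp

lemma N_minus_commute:
  assumes "s \<in> V" "t \<in> V"
  shows "N (s - t) = N (t - s)"
proof -
  have "seq_scale smul (-1) (s - t) = t - s"
    by (simp add: seq_scale_def fun_eq_iff)
  then show ?thesis
    using N_scale[OF diff_mem[OF assms], of "-1"] by simp
qed

sublocale Metric_space V "norm_dist V N"
proof
  fix s t u
  show "0 \<le> norm_dist V N s t"
    by (simp add: norm_dist_def N_nonneg diff_mem)
  show "norm_dist V N s t = norm_dist V N t s"
    by (simp add: norm_dist_def N_minus_commute)
  assume "s \<in> V" "t \<in> V"
  then show "norm_dist V N s t = 0 \<longleftrightarrow> s = t"
    by (simp add: norm_dist_def N_eq_0_iff diff_mem)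
  assume "u \<in> V"
  then show "norm_dist V N s u \<le> norm_dist V N s t + norm_dist V N t u"
    using \<open>s \<in> V\<close> \<open>t \<in> V\<close> N_triangle[of "s - t" "t - u"]
    by (simp add: norm_dist_def diff_mem)
qed

text \<open>Rescale \<open>v\<close> by \<open>r / N v\<close> into the ball where the bound is
  given; if \<open>N v = 0\<close>, then \<open>v = 0\<close> and homogeneity with scalar 0 gives
  \<open>\<phi> v = 0\<close>. This is how every supremum over the unit ball becomes an estimate on
  all of \<open>V\<close>.\<close>

lemma homogeneous_le:
  assumes bound: "\<And>v. v \<in> V \<Longrightarrow> N v \<le> r \<Longrightarrow> \<phi> v \<le> B"
    and "0 < r"
    and homogeneous: "\<And>a v. v \<in> V \<Longrightarrow> \<phi> (seq_scale smul a v) = norm a * \<phi> v"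
    and "v \<in> V"
  shows "\<phi> v \<le> B / r * N v"
proof (cases "N v = 0")
  case True
  then have "v = 0"
    using N_eq_0_iff \<open>v \<in> V\<close> by simp
  moreover have "seq_scale smul 0 v = 0"
    by (simp add: seq_scale_def fun_eq_iff)
  ultimately have "\<phi> v = 0"
    using homogeneous[OF \<open>v \<in> V\<close>, of 0] by simp
  then show ?thesis
    using True by simp
next
  case False
  then have pos: "N v > 0"
    using N_nonneg[OF \<open>v \<in> V\<close>] by simp
  let ?a = "of_real (r / N v) :: 'k"
  have a: "norm ?a = r / N v"
    using pos \<open>0 < r\<close> by (simp only: norm_of_real) simp
  have "N (seq_scale smul ?a v) \<le> r"
    unfolding N_scale[OF \<open>v \<in> V\<close>] a using pos by simp
  then have "norm ?a * \<phi> v \<le> B"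
    using bound[OF scale_mem[OF \<open>v \<in> V\<close>]] homogeneous[OF \<open>v \<in> V\<close>] by metis
  then show ?thesis
    unfolding a using pos \<open>0 < r\<close> by (simp add: field_simps)
qed

text \<open>Banach-Steinhaus by Baire category, for a norm living on a carrier set. Homogeneity is
  stated for norms because the target type has only real scalars, not those in
  \<open>'k\<close>.\<close>

lemma uniform_boundedness:
  fixes T :: "'i \<Rightarrow> (nat \<Rightarrow> 'x) \<Rightarrow> 'y::real_normed_vector"
  assumes mcomplete
    and cont: "\<And>i. continuous_map mtopology euclidean (T i)"
    and add: "\<And>i v w. v \<in> V \<Longrightarrow> w \<in> V \<Longrightarrow> T i (v + w) = T i v + T i w"
    and homogeneous: "\<And>i a v. v \<in> V \<Longrightarrow> norm (T i (seq_scale smul a v)) = norm a * norm (T i v)"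
    and pointwise: "\<And>v. v \<in> V \<Longrightarrow> \<exists>B. \<forall>i. norm (T i v) \<le> B"
  shows "\<exists>B. \<forall>i. \<forall>v\<in>V. norm (T i v) \<le> B * N v"
proof -
  define F where "F m = {v \<in> V. \<forall>i. norm (T i v) \<le> real m}" for m :: nat
  have closed: "closedin mtopology (F m)" for m
  proof -
    have "closedin mtopology {v \<in> topspace mtopology. norm (T i v) \<in> {..real m}}" for i
      by (rule closedin_continuous_map_preimage[of _ euclideanreal])
        (use continuous_map_norm[OF cont] in auto)
    then have "closedin mtopology (\<Inter>i. {v \<in> V. norm (T i v) \<le> real m})"
      by (intro closedin_INT) auto
    moreover have "F m = (\<Inter>i. {v \<in> V. norm (T i v) \<le> real m})"
      by (auto simp: F_def)
    ultimately show ?thesis by simp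
  qed
  \<comment> \<open>Pointwise boundedness says exactly that the closed sets \<open>F m\<close>
    exhaust \<open>V\<close>.\<close>
  have "\<Union>(range F) = V"
  proof (intro equalityI subsetI)
    fix v assume "v \<in> V"
    then obtain B where B: "\<And>i. norm (T i v) \<le> B"
      using pointwise by blast
    obtain m where "B \<le> real m"
      using real_arch_simple by blast
    then have "v \<in> F m"
      using \<open>v \<in> V\<close> B by (auto simp: F_def intro: order_trans)
    then show "v \<in> \<Union>(range F)" by blast
  qed (auto simp: F_def)
  \<comment> \<open>Baire is used in contrapositive form: the countable union \<open>V\<close> is
    open and nonempty, so some \<open>F m\<close> has an interior point.\<close>
  moreover have "mtopology interior_of V \<noteq> {}"
    using interior_of_topspace[of mtopology] zero_mem by auto
  ultimately obtain m where "mtopology interior_of F m \<noteq> {}"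
    using metric_Baire_category_alt[OF \<open>mcomplete\<close>, of "range F"] closed by auto
  then obtain v0 r where v0: "v0 \<in> V" and "0 < r" and ball: "mcball v0 r \<subseteq> F m"
    by (auto simp: in_interior_of_mcball)
  \<comment> \<open>The factor 2 comes from writing \<open>w\<close> as the difference of
    \<open>v0 + w\<close> and \<open>v0\<close>, both in the ball inside \<open>F m\<close>.\<close>
  have near: "norm (T i w) \<le> 2 * real m" if "w \<in> V" "N w \<le> r" for i w
  proof -
    have "v0 + w \<in> F m" "v0 \<in> F m"
      using that v0 \<open>0 < r\<close> N_minus_commute[of v0 "v0 + w"]
      by (auto intro!: subsetD[OF ball] simp: norm_dist_def add_mem N_zero)
    then have "norm (T i v0 + T i w) \<le> real m" "norm (T i v0) \<le> real m"
      using add[OF v0 \<open>w \<in> V\<close>] by (auto simp: F_def)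
    then show ?thesis
      using norm_triangle_ineq4[of "T i v0 + T i w" "T i v0"] by simp
  qed
  have "norm (T i v) \<le> 2 * real m / r * N v" if "v \<in> V" for i v
    using homogeneous_le[of r "\<lambda>v. norm (T i v)", OF near \<open>0 < r\<close> homogeneous that] .
  then show ?thesis by blast
qed

end

section \<open>Continuity of the scalar action and algebra of the coordinatewise product\<close>

context banach_space_over
begin

lemma norm_smul_diff_right: "norm (smul a x - smul a y) = norm a * norm (x - y)"
  by (metis norm_smul scale_right_diff_distrib)

lemma norm_smul_diff_left: "norm (smul a x - smul b x) = norm (a - b) * norm x"
  by (metis norm_smul scale_left_diff_distrib)

lemma tendsto_smul:
  assumes "(g \<longlongrightarrow> x) F"
  shows "((\<lambda>i. smul a (g i)) \<longlongrightarrow> smul a x) F"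
proof (rule LIM_zero_cancel, rule tendsto_norm_zero_cancel)
  have "((\<lambda>i. norm a * norm (g i - x)) \<longlongrightarrow> norm a * norm (x - x)) F"
    by (intro tendsto_intros assms)
  then show "((\<lambda>i. norm (smul a (g i) - smul a x)) \<longlongrightarrow> 0) F"
    unfolding norm_smul_diff_right by simp
qed

text \<open>The map is Lipschitz with constant \<open>norm x\<close>. Composed with the continuous
  coordinates of \<open>V\<close>, it makes the partial sums of \<open>seq_mult smul v f\<close>
  continuous in \<open>v\<close>.\<close>

lemma continuous_smul: "continuous_on UNIV (\<lambda>a. smul a x)"
  unfolding continuous_on_def
proof (intro ballI, rule LIM_zero_cancel, rule tendsto_norm_zero_cancel)
  fix b :: 'k
  have "((\<lambda>a. norm (a - b) * norm x) \<longlongrightarrow> norm (b - b) * norm x) (at b)"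
    by (intro tendsto_intros)
  then show "((\<lambda>a. norm (smul a x - smul b x)) \<longlongrightarrow> 0) (at b)"
    unfolding norm_smul_diff_left by simp
qed

lemma sums_smul: "g sums x \<Longrightarrow> (\<lambda>n. smul a (g n)) sums smul a x"
  using tendsto_smul by (simp add: sums_def flip: scale_sum_right)

lemma seq_mult_add_left: "seq_mult smul (v + w) f = seq_mult smul v f + seq_mult smul w f"
  by (simp add: seq_mult_def fun_eq_iff scale_left_distrib)

lemma seq_mult_add_right: "seq_mult smul v (f + g) = (\<lambda>n. seq_mult smul v f n + seq_mult smul v g n)"
  by (simp add: seq_mult_def fun_eq_iff scale_right_distrib)

lemma seq_mult_diff_right: "seq_mult smul v (f - g) = seq_mult smul v f - seq_mult smul v g"
  by (simp add: seq_mult_def fun_eq_iff scale_right_diff_distrib)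

lemma seq_mult_scale_left:
  "seq_mult smul (seq_scale (*) a v) f = (\<lambda>n. smul a (seq_mult smul v f n))"
  by (simp add: seq_mult_def seq_scale_def fun_eq_iff)

lemma seq_mult_scale_right:
  "seq_mult smul v (seq_scale smul a f) = (\<lambda>n. smul a (seq_mult smul v f n))"
  by (simp add: seq_mult_def seq_scale_def fun_eq_iff mult.commute)

lemma seq_mult_unit_sums: "seq_mult smul (unit_seq k) f sums f k"
proof -
  have "seq_mult smul (unit_seq k) f = (\<lambda>n. if n = k then f n else 0)"
    by (auto simp: seq_mult_def unit_seq_def)
  then show ?thesis
    using sums_single[of k f] by simp
qed

end

section \<open>Truncations and partial sums\<close>

lemma section_proj_apply: "section_proj n v k = (if k \<le> n then v k else 0)"
proof -
  have "(\<Sum>j\<in>A. h j) k = (\<Sum>j\<in>A. h j k)" for A and h :: "nat \<Rightarrow> nat \<Rightarrow> 'a"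
    by (induction A rule: infinite_finite_induct) auto
  then show ?thesis
    by (simp add: section_proj_def seq_scale_def unit_seq_def if_distrib cong: if_cong)
qed

lemma section_proj_scale:
  "section_proj n (seq_scale (*) a v) = seq_scale (*) a (section_proj n v)"
  by (simp add: fun_eq_iff section_proj_apply seq_scale_def)

text \<open>Convergent sequences are bounded. \<open>Sigma_c_norm\<close> is a real supremum, so
  this boundedness is what gives it its meaning on \<open>Sigma_c\<close>.\<close>

lemma Sigma_c_bdd_above:
  fixes s :: "nat \<Rightarrow> 'x::banach"
  assumes "s \<in> Sigma_c"
  shows "bdd_above (range (\<lambda>n. norm (\<Sum>k\<le>n. s k)))"
proof -
  have "(\<lambda>n. \<Sum>k\<le>n. s k) \<longlonglongrightarrow> suminf s"
    using assms by (simp add: Sigma_c_def summable_LIMSEQ')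
  then have "Bseq (\<lambda>n. \<Sum>k\<le>n. s k)"
    by (rule convergentI[THEN convergent_imp_Bseq])
  then show ?thesis
    by (auto simp: Bseq_def bdd_above_def)
qed

text \<open>The sum is the limit of partial sums whose norms are at most the supremum. The upper
  estimate in the norm comparison rests on this.\<close>

lemma norm_suminf_le_Sigma_c_norm:
  fixes s :: "nat \<Rightarrow> 'x::banach"
  assumes "s \<in> Sigma_c"
  shows "norm (suminf s) \<le> Sigma_c_norm s"
proof (rule LIMSEQ_le_const2)
  show "(\<lambda>n. norm (\<Sum>k\<le>n. s k)) \<longlonglongrightarrow> norm (suminf s)"
    using assms by (intro tendsto_norm) (simp add: Sigma_c_def summable_LIMSEQ')
  show "\<exists>M. \<forall>n\<ge>M. norm (\<Sum>k\<le>n. s k) \<le> Sigma_c_norm s"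
    unfolding Sigma_c_norm_def using cSUP_upper[OF UNIV_I Sigma_c_bdd_above[OF assms]] by blast
qed

section \<open>Estimates for multipliers under the standing hypotheses on \<open>V\<close>\<close>

locale multiplier_space =
  X: banach_space_over smul + BK: BK_space "(*)" V N
  for smul :: "'k::real_normed_field \<Rightarrow> 'x::banach \<Rightarrow> 'x"
    and V :: "(nat \<Rightarrow> 'k) set" and N +
  assumes unit: "\<And>n. unit_seq n \<in> V"
    and finite_nu: "nu V N < \<infinity>"
begin

sublocale V: normed_sequence_space "(*)" V N
  using BK.subspace BK.norm_nonneg BK.norm_eq_0_iff BK.norm_triangle BK.norm_seq_scale
  by unfold_locales (auto simp: algebra_simps)

lemma section_proj_mem: "section_proj n v \<in> V"
  unfolding section_proj_def
  by (intro V.sum_mem V.scale_mem unit)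

lemma section_proj_le:
  assumes "v \<in> V"
  shows "N (section_proj n v) \<le> enn2real (nu V N) * N v"
proof -
  have "N (section_proj n w) \<le> enn2real (nu V N)" if "w \<in> V" "N w \<le> 1" for w
  proof -
    have "ennreal (N (section_proj n w)) \<le> nu V N"
      unfolding nu_def using that by (intro SUP_upper2[of n] SUP_upper2[of w]) auto
    then show ?thesis
      using finite_nu enn2real_mono[of "ennreal (N (section_proj n w))" "nu V N"]
      by (simp add: V.N_nonneg section_proj_mem)
  qed
  from V.homogeneous_le[of 1 "\<lambda>v. N (section_proj n v)", OF this _ _ assms]
  show ?thesis
    by (simp add: section_proj_scale V.N_scale section_proj_mem)
qed

text \<open>The terms after index \<open>n\<close> vanish, so the series is a finite sum. Bounds on
  full sums thereby turn into bounds on partial sums.\<close>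

lemma section_proj_sums:
  "seq_mult smul (section_proj n v) f sums (\<Sum>k\<le>n. seq_mult smul v f k)"
proof -
  have "seq_mult smul (section_proj n v) f sums
      (\<Sum>k\<le>n. seq_mult smul (section_proj n v) f k)"
    by (rule sums_finite) (auto simp: seq_mult_def section_proj_apply)
  then show ?thesis
    by (simp add: seq_mult_def section_proj_apply)
qed

lemma M_Sigma_summable: "f \<in> M_Sigma smul V \<Longrightarrow> v \<in> V \<Longrightarrow> summable (seq_mult smul v f)"
  by (simp add: M_Sigma_def mult_space_def Sigma_c_def)

lemma M_Sigma_memI: "(\<And>v. v \<in> V \<Longrightarrow> summable (seq_mult smul v f)) \<Longrightarrow> f \<in> M_Sigma smul V"
  by (simp add: M_Sigma_def mult_space_def Sigma_c_def)

text \<open>Uniform boundedness applied to the partial sum maps indexed by \<open>n\<close>: each is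
  continuous on the complete space \<open>V\<close>, and for fixed \<open>v\<close> they are bounded
  since the series converges.\<close>

lemma partial_sums_bounded:
  assumes f: "f \<in> M_Sigma smul V"
  shows "\<exists>B. \<forall>n. \<forall>v\<in>V. norm (\<Sum>k\<le>n. seq_mult smul v f k) \<le> B * N v"
proof (rule V.uniform_boundedness[of "\<lambda>n v. \<Sum>k\<le>n. seq_mult smul v f k"])
  show V.mcomplete by (rule BK.complete)
  show "continuous_map V.mtopology euclidean (\<lambda>v. \<Sum>k\<le>n. seq_mult smul v f k)" for n
  proof (rule continuous_map_sum)
    fix k
    show "continuous_map V.mtopology euclidean (\<lambda>v. seq_mult smul v f k)"
      using continuous_map_compose[OF BK.continuous_coordinate[of k], of euclidean "\<lambda>a. smul a (f k)"]
        X.continuous_smul[of "f k"]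
      by (simp add: seq_mult_def o_def)
  qed simp
  have scale: "(\<Sum>k\<le>n. seq_mult smul (seq_scale (*) a v) f k)
      = smul a (\<Sum>k\<le>n. seq_mult smul v f k)" for n a v
    unfolding X.seq_mult_scale_left X.scale_sum_right ..
  show "(\<Sum>k\<le>n. seq_mult smul (v + w) f k)
      = (\<Sum>k\<le>n. seq_mult smul v f k) + (\<Sum>k\<le>n. seq_mult smul w f k)" for n v w
    by (simp add: X.seq_mult_add_left sum.distrib)
  show "norm (\<Sum>k\<le>n. seq_mult smul (seq_scale (*) a v) f k)
      = norm a * norm (\<Sum>k\<le>n. seq_mult smul v f k)" for n a v
    unfolding scale X.norm_smul ..
  show "\<exists>B. \<forall>n. norm (\<Sum>k\<le>n. seq_mult smul v f k) \<le> B" if "v \<in> V" for v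
  proof -
    have "seq_mult smul v f \<in> Sigma_c"
      using M_Sigma_summable[OF f that] by (simp add: Sigma_c_def)
    from Sigma_c_bdd_above[OF this] show ?thesis
      unfolding bdd_above_def by blast
  qed
qed

lemma M_Sigma_norm_finite:
  assumes f: "f \<in> M_Sigma smul V"
  shows "M_Sigma_norm smul V N f < \<infinity>"
proof -
  obtain B where B: "\<And>n v. v \<in> V \<Longrightarrow> norm (\<Sum>k\<le>n. seq_mult smul v f k) \<le> B * N v"
    using partial_sums_bounded[OF f] by blast
  \<comment> \<open>The absolute value is taken because the sign of \<open>B\<close> is not
    provided.\<close>
  have "norm (suminf (seq_mult smul v f)) \<le> \<bar>B\<bar>" if v: "v \<in> V" "N v \<le> 1" for v
  proof -
    have "B * N v \<le> \<bar>B\<bar> * 1"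
      using v V.N_nonneg by (intro mult_mono) auto
    then have "Sigma_c_norm (seq_mult smul v f) \<le> \<bar>B\<bar>"
      unfolding Sigma_c_norm_def using B[OF \<open>v \<in> V\<close>]
      by (intro cSUP_least) (auto intro: order_trans)
    then show ?thesis
      using norm_suminf_le_Sigma_c_norm[of "seq_mult smul v f"] M_Sigma_summable[OF f \<open>v \<in> V\<close>]
      by (simp add: Sigma_c_def)
  qed
  then have "M_Sigma_norm smul V N f \<le> ennreal \<bar>B\<bar>"
    unfolding M_Sigma_norm_def by (intro SUP_least ennreal_leI) auto
  then show ?thesis
    using ennreal_less_top le_less_trans by (metis infinity_ennreal_def)
qed

text \<open>The real-valued norm. As \<open>enn2real\<close> sends infinity to 0, it is faithful
  only where \<open>M_Sigma_norm_finite\<close> applies.\<close>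

abbreviation p :: "(nat \<Rightarrow> 'x) \<Rightarrow> real" where
  "p f \<equiv> enn2real (M_Sigma_norm smul V N f)"

lemma norm_suminf_le:
  assumes f: "f \<in> M_Sigma smul V" and "v \<in> V"
  shows "norm (suminf (seq_mult smul v f)) \<le> p f * N v"
proof -
  have "norm (suminf (seq_mult smul w f)) \<le> p f" if "w \<in> V" "N w \<le> 1" for w
  proof -
    have "ennreal (norm (suminf (seq_mult smul w f))) \<le> M_Sigma_norm smul V N f"
      unfolding M_Sigma_norm_def using that by (intro SUP_upper2[of w]) auto
    then show ?thesis
      using M_Sigma_norm_finite[OF f] enn2real_mono by fastforce
  qed
  moreover have "norm (suminf (seq_mult smul (seq_scale (*) a w) f))
      = norm a * norm (suminf (seq_mult smul w f))" if "w \<in> V" for a w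
    using X.sums_smul[OF summable_sums[OF M_Sigma_summable[OF f that]], of a]
    by (simp add: X.seq_mult_scale_left X.norm_smul sums_iff)
  ultimately show ?thesis
    using V.homogeneous_le[of 1 "\<lambda>v. norm (suminf (seq_mult smul v f))" "p f" v] \<open>v \<in> V\<close>
    by simp
qed

text \<open>The supremum is at most \<open>ennreal c\<close>, hence finite. Nonnegativity of
  \<open>c\<close> matters because \<open>ennreal\<close> sends negative reals to 0.\<close>

lemma p_le:
  assumes "0 \<le> c" "\<And>v. v \<in> V \<Longrightarrow> N v \<le> 1 \<Longrightarrow> norm (suminf (seq_mult smul v f)) \<le> c"
  shows "p f \<le> c"
proof -
  have "M_Sigma_norm smul V N f \<le> ennreal c"
    unfolding M_Sigma_norm_def using assms by (intro SUP_least ennreal_leI) auto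
  then show ?thesis
    using enn2real_mono[of _ "ennreal c"] \<open>0 \<le> c\<close> by simp
qed

text \<open>The central estimate: test \<open>f\<close> on \<open>section_proj n v\<close>, whose
  norm exceeds that of \<open>v\<close> by at most the factor \<open>nu V N\<close>.\<close>

lemma norm_partial_sum_le:
  assumes f: "f \<in> M_Sigma smul V" and v: "v \<in> V"
  shows "norm (\<Sum>k\<le>n. seq_mult smul v f k) \<le> enn2real (nu V N) * p f * N v"
proof -
  have "norm (\<Sum>k\<le>n. seq_mult smul v f k) \<le> p f * N (section_proj n v)"
    using norm_suminf_le[OF f section_proj_mem[of n v]]
    by (simp add: sums_unique[OF section_proj_sums, symmetric])
  also have "\<dots> \<le> p f * (enn2real (nu V N) * N v)"
    by (intro mult_left_mono section_proj_le v) simp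
  finally show ?thesis by (simp add: mult_ac)
qed

text \<open>Testing on \<open>unit_seq k\<close> leaves the single term \<open>f k\<close>.
  Definiteness of \<open>p\<close>, coordinatewise convergence of Cauchy sequences and continuity of
  coordinates all follow from this.\<close>

lemma norm_coordinate_le:
  assumes "f \<in> M_Sigma smul V"
  shows "norm (f k) \<le> p f * N (unit_seq k)"
  using norm_suminf_le[OF assms unit[of k]]
  by (simp add: sums_unique[OF X.seq_mult_unit_sums, symmetric])

section \<open>The BK-space structure of \<open>M_Sigma smul V\<close>\<close>

sublocale M: normed_sequence_space smul "M_Sigma smul V" p
proof
  interpret seq: module "seq_scale smul"
    by (rule module_seq_scale) unfold_locales
  have zero: "seq_mult smul v 0 = (\<lambda>n. 0)" for v
    by (simp add: seq_mult_def fun_eq_iff)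
  have scale: "seq_mult smul v (seq_scale smul a f) sums smul a (suminf (seq_mult smul v f))"
    if "f \<in> M_Sigma smul V" "v \<in> V" for a f v
    using X.sums_smul[OF summable_sums[OF M_Sigma_summable[OF that]]]
    by (simp add: X.seq_mult_scale_right)
  have add: "seq_mult smul v (f + g)
      sums (suminf (seq_mult smul v f) + suminf (seq_mult smul v g))"
    if "f \<in> M_Sigma smul V" "g \<in> M_Sigma smul V" "v \<in> V" for f g v
    using sums_add[OF summable_sums[OF M_Sigma_summable[OF that(1,3)]]
        summable_sums[OF M_Sigma_summable[OF that(2,3)]]]
    unfolding X.seq_mult_add_right .
  show "module.subspace (seq_scale smul) (M_Sigma smul V)"
    by (intro seq.subspaceI M_Sigma_memI)
      (use add scale in \<open>auto simp: zero sums_iff\<close>)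
  fix f g and a :: 'k
  assume f: "f \<in> M_Sigma smul V"
  show "0 \<le> p f" by simp
  show "p f = 0 \<longleftrightarrow> f = 0"
  proof
    assume "p f = 0"
    then show "f = 0"
      using norm_coordinate_le[OF f] by (simp add: fun_eq_iff)
  next
    assume "f = 0"
    then have "p f \<le> 0"
      by (intro p_le) (auto simp: zero)
    then show "p f = 0"
      by (intro antisym) auto
  qed
  \<comment> \<open>One inequality suffices: for \<open>a\<close> nonzero, the reverse one results
    from applying it to \<open>inverse a\<close> and the scaled sequence.\<close>
  have p_scale_le: "p (seq_scale smul b h) \<le> norm b * p h" if h: "h \<in> M_Sigma smul V" for b h
  proof (rule p_le)
    fix v assume v: "v \<in> V" "N v \<le> 1"
    have "norm (suminf (seq_mult smul v (seq_scale smul b h)))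
        = norm b * norm (suminf (seq_mult smul v h))"
      using scale[OF h \<open>v \<in> V\<close>, of b] by (simp add: sums_iff X.norm_smul)
    also have "\<dots> \<le> norm b * (p h * N v)"
      by (intro mult_left_mono norm_suminf_le h v) simp
    also have "\<dots> \<le> norm b * p h"
      using v by (intro mult_left_mono mult_left_le) auto
    finally show "norm (suminf (seq_mult smul v (seq_scale smul b h))) \<le> norm b * p h" .
  qed simp
  show "p (seq_scale smul a f) = norm a * p f"
  proof (cases "a = 0")
    case True
    then show ?thesis
      using p_scale_le[OF f, of a] by (intro antisym) auto
  next
    case False
    have mem: "seq_scale smul a f \<in> M_Sigma smul V"
      by (intro M_Sigma_memI) (use scale[OF f] in \<open>auto simp: sums_iff\<close>)
    have "seq_scale smul (inverse a) (seq_scale smul a f) = f"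
      using False by (simp add: seq_scale_def)
    then have "p f \<le> inverse (norm a) * p (seq_scale smul a f)"
      using p_scale_le[OF mem, of "inverse a"] by (simp add: norm_inverse)
    then have "norm a * p f \<le> p (seq_scale smul a f)"
      using False by (simp add: field_simps)
    then show ?thesis
      using p_scale_le[OF f, of a] by (intro antisym)
  qed
  assume g: "g \<in> M_Sigma smul V"
  show "p (f + g) \<le> p f + p g"
  proof (rule p_le)
    fix v assume v: "v \<in> V" "N v \<le> 1"
    have "norm (suminf (seq_mult smul v (f + g)))
        \<le> norm (suminf (seq_mult smul v f)) + norm (suminf (seq_mult smul v g))"
      using add[OF f g \<open>v \<in> V\<close>] by (simp add: sums_iff norm_triangle_ineq)
    also have "\<dots> \<le> p f * N v + p g * N v"
      by (intro add_mono norm_suminf_le f g v)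
    also have "\<dots> \<le> p f + p g"
      using v by (intro add_mono mult_left_le) auto
    finally show "norm (suminf (seq_mult smul v (f + g))) \<le> p f + p g" .
  qed simp
qed

text \<open>The coordinatewise limit is the candidate. The estimate on partial sums, uniform in
  \<open>n\<close>, shows first that it is a multiplier and then that convergence holds in
  norm.\<close>

lemma M_Sigma_mcomplete: M.mcomplete
  unfolding M.mcomplete_def
proof (intro allI impI)
  fix F assume "M.MCauchy F"
  then have F: "\<And>i. F i \<in> M_Sigma smul V"
    by (auto simp: M.MCauchy_def)
  then have Cauchy: "\<exists>I. \<forall>i\<ge>I. \<forall>j\<ge>I. p (F i - F j) < e" if "e > 0" for e
    using \<open>M.MCauchy F\<close> that by (simp add: M.MCauchy_def norm_dist_def)
  have "Cauchy (\<lambda>i. F i k)" for k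
  proof (rule metric_CauchyI)
    fix e :: real assume "e > 0"
    \<comment> \<open>Adding 1 yields a positive divisor without a separate argument that
      \<open>unit_seq k\<close> has nonzero norm.\<close>
    define c where "c = N (unit_seq k) + 1"
    have "c > 0"
      using V.N_nonneg[OF unit[of k]] by (simp add: c_def)
    then obtain I where I: "\<And>i j. i \<ge> I \<Longrightarrow> j \<ge> I \<Longrightarrow> p (F i - F j) < e / c"
      using Cauchy[of "e / c"] \<open>e > 0\<close> by auto
    have "dist (F i k) (F j k) < e" if "i \<ge> I" "j \<ge> I" for i j
    proof -
      have "dist (F i k) (F j k) \<le> p (F i - F j) * N (unit_seq k)"
        using norm_coordinate_le[OF M.diff_mem[OF F F], of i j k] by (simp add: dist_norm)
      also have "\<dots> \<le> p (F i - F j) * c"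
        by (intro mult_left_mono) (auto simp: c_def)
      also have "\<dots> < e"
        using I[OF that] \<open>c > 0\<close> by (simp add: field_simps)
      finally show ?thesis .
    qed
    then show "\<exists>I. \<forall>i\<ge>I. \<forall>j\<ge>I. dist (F i k) (F j k) < e" by blast
  qed
  then have "\<exists>x. (\<lambda>i. F i k) \<longlonglongrightarrow> x" for k
    using Cauchy_convergent convergent_def by blast
  then obtain f where f: "\<And>k. (\<lambda>i. F i k) \<longlonglongrightarrow> f k" by metis
  define c where "c = enn2real (nu V N)"
  have "c \<ge> 0" by (simp add: c_def)
  \<comment> \<open>For fixed \<open>n\<close> the sum is finite, so coordinatewise convergence
    allows \<open>j\<close> to tend to infinity in the bound for \<open>F i - F j\<close>. The index
    \<open>I\<close> depends on neither \<open>n\<close> nor \<open>v\<close>.\<close>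
  have partial: "\<exists>I. \<forall>i\<ge>I. \<forall>v\<in>V. \<forall>n. norm (\<Sum>k\<le>n. seq_mult smul v (F i - f) k) \<le> e * N v"
    if "e > 0" for e
  proof -
    obtain I where I: "\<And>i j. i \<ge> I \<Longrightarrow> j \<ge> I \<Longrightarrow> p (F i - F j) < e / (c + 1)"
      using Cauchy[of "e / (c + 1)"] \<open>e > 0\<close> \<open>c \<ge> 0\<close> by auto
    have "norm (\<Sum>k\<le>n. seq_mult smul v (F i - f) k) \<le> e * N v" if "i \<ge> I" "v \<in> V" for i v n
    proof (rule LIMSEQ_le_const2)
      show "(\<lambda>j. norm (\<Sum>k\<le>n. seq_mult smul v (F i - F j) k))
          \<longlonglongrightarrow> norm (\<Sum>k\<le>n. seq_mult smul v (F i - f) k)"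
        unfolding seq_mult_def
        by (intro tendsto_norm tendsto_sum X.tendsto_smul) (simp add: tendsto_diff f)
      have "norm (\<Sum>k\<le>n. seq_mult smul v (F i - F j) k) \<le> e * N v" if "j \<ge> I" for j
      proof -
        have "c * p (F i - F j) \<le> (c + 1) * (e / (c + 1))"
          using I[OF \<open>i \<ge> I\<close> that] \<open>c \<ge> 0\<close> by (intro mult_mono) auto
        then have "c * p (F i - F j) \<le> e"
          using \<open>c \<ge> 0\<close> by simp
        then have "c * p (F i - F j) * N v \<le> e * N v"
          by (intro mult_right_mono V.N_nonneg \<open>v \<in> V\<close>)
        then show ?thesis
          using norm_partial_sum_le[OF M.diff_mem[OF F F] \<open>v \<in> V\<close>, of i j n]
          unfolding c_def by (rule order_trans[rotated])
      qed
      then show "\<exists>J. \<forall>j\<ge>J. norm (\<Sum>k\<le>n. seq_mult smul v (F i - F j) k) \<le> e * N v" by blast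
    qed
    then show ?thesis by blast
  qed
  have "f \<in> M_Sigma smul V"
  proof (rule M_Sigma_memI)
    fix v assume v: "v \<in> V"
    let ?S = "\<lambda>g n. \<Sum>k\<le>n. seq_mult smul v g k"
    \<comment> \<open>A three-epsilon argument: the partial sums for \<open>f\<close> are uniformly
      close to those for one \<open>F i\<close>, which form a Cauchy sequence.\<close>
    have "Cauchy (?S f)"
    proof (rule metric_CauchyI)
      fix e :: real assume "e > 0"
      define e' where "e' = e / 3 / (N v + 1)"
      have "N v \<ge> 0" by (rule V.N_nonneg[OF v])
      then have "e' > 0" "e' * N v < e / 3"
        using \<open>e > 0\<close> by (auto simp: e'_def field_simps)
      then obtain i where "\<And>n. norm (?S (F i - f) n) < e / 3"
        using partial[OF \<open>e' > 0\<close>] v by (meson le_less_trans order_refl)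
      then have i: "dist (?S (F i) n) (?S f n) < e / 3" for n
        by (simp add: dist_norm X.seq_mult_diff_right sum_subtractf)
      have "Cauchy (?S (F i))"
        using M_Sigma_summable[OF F v] by (simp add: summable_iff_convergent' Cauchy_convergent_iff)
      then obtain M where M: "\<And>m n. m \<ge> M \<Longrightarrow> n \<ge> M \<Longrightarrow> dist (?S (F i) m) (?S (F i) n) < e / 3"
        using \<open>e > 0\<close> by (meson metric_CauchyD zero_less_divide_iff zero_less_numeral)
      have "dist (?S f m) (?S f n) < e" if "m \<ge> M" "n \<ge> M" for m n
        using dist_triangle_third[of "?S f m" "?S (F i) m" e "?S (F i) n" "?S f n"]
          i M[OF that] by (simp add: dist_commute)
      then show "\<exists>M. \<forall>m\<ge>M. \<forall>n\<ge>M. dist (?S f m) (?S f n) < e" by blast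
    qed
    then show "summable (seq_mult smul v f)"
      by (simp add: summable_iff_convergent' Cauchy_convergent_iff)
  qed
  moreover have "\<exists>I. \<forall>i\<ge>I. p (F i - f) < e" if "e > 0" for e
  proof -
    \<comment> \<open>Half of \<open>e\<close> leaves room for the strict inequality after passing
      to the supremum over the unit ball.\<close>
    obtain I where I: "\<And>i v n. i \<ge> I \<Longrightarrow> v \<in> V \<Longrightarrow>
        norm (\<Sum>k\<le>n. seq_mult smul v (F i - f) k) \<le> e / 2 * N v"
      using partial[of "e / 2"] \<open>e > 0\<close> by auto
    have "p (F i - f) \<le> e / 2" if "i \<ge> I" for i
    proof (rule p_le)
      fix v assume v: "v \<in> V" "N v \<le> 1"
      have "norm (\<Sum>k\<le>n. seq_mult smul v (F i - f) k) \<le> e / 2" for n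
      proof -
        have "e / 2 * N v \<le> e / 2"
          using v \<open>e > 0\<close> by (intro mult_left_le) auto
        then show ?thesis
          using I[OF that \<open>v \<in> V\<close>] by (rule order_trans[rotated])
      qed
      then have "Sigma_c_norm (seq_mult smul v (F i - f)) \<le> e / 2"
        unfolding Sigma_c_norm_def by (intro cSUP_least) auto
      moreover have "seq_mult smul v (F i - f) \<in> Sigma_c"
        using M_Sigma_summable[OF M.diff_mem[OF F \<open>f \<in> M_Sigma smul V\<close>] \<open>v \<in> V\<close>]
        by (simp add: Sigma_c_def)
      ultimately show "norm (suminf (seq_mult smul v (F i - f))) \<le> e / 2"
        by (meson norm_suminf_le_Sigma_c_norm order_trans)
    qed (use \<open>e > 0\<close> in simp)
    then show ?thesis
      using \<open>e > 0\<close> by (intro exI[of _ I]) fastforce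
  qed
  ultimately have "limitin M.mtopology F f sequentially"
    by (auto simp: M.limit_metric_sequentially norm_dist_def F)
  then show "\<exists>f. limitin M.mtopology F f sequentially" by blast
qed

text \<open>By \<open>norm_coordinate_le\<close>, each coordinate is Lipschitz.\<close>

lemma M_Sigma_continuous_coordinate:
  "continuous_map M.mtopology euclidean (\<lambda>f. f k)"
  unfolding M.continuous_map_from_metric
proof (intro conjI ballI allI impI)
  fix f U assume f: "f \<in> M_Sigma smul V" and U: "openin euclidean U \<and> f k \<in> U"
  then obtain e where "e > 0" and e: "\<And>y. dist y (f k) < e \<Longrightarrow> y \<in> U"
    by (auto simp: open_dist)
  define c where "c = N (unit_seq k) + 1"
  have "c > 0"
    using V.N_nonneg[OF unit[of k]] by (simp add: c_def)
  have "g k \<in> U" if g: "g \<in> M_Sigma smul V" and d: "norm_dist (M_Sigma smul V) p f g < e / c" for g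
  proof -
    have "norm ((f - g) k) \<le> p (f - g) * c"
      using norm_coordinate_le[OF M.diff_mem[OF f g], of k]
      by (rule order_trans) (auto intro!: mult_left_mono simp: c_def)
    also have "\<dots> < e"
      using d f g \<open>c > 0\<close> by (simp add: norm_dist_def field_simps)
    finally show ?thesis
      by (intro e) (simp add: dist_norm norm_minus_commute)
  qed
  then show "\<exists>r>0. \<forall>g. g \<in> M_Sigma smul V \<and> norm_dist (M_Sigma smul V) p f g < r \<longrightarrow> g k \<in> U"
    using \<open>e > 0\<close> \<open>c > 0\<close> by (intro exI[of _ "e / c"]) auto
qed auto

lemma BK_space_M_Sigma: "BK_space smul (M_Sigma smul V) p"
  by (intro BK_space.intro M.seq_subspace M.N_nonneg M.N_eq_0_iff M.N_triangle M.N_scale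
      M_Sigma_mcomplete M_Sigma_continuous_coordinate)

section \<open>Comparison of the two norms\<close>

lemma M_Sigma_norm_le_mult_norm:
  assumes "f \<in> M_Sigma smul V"
  shows "M_Sigma_norm smul V N f \<le> mult_norm smul V N Sigma_c_norm f"
  unfolding M_Sigma_norm_def mult_norm_def
  using assms
  by (fastforce intro!: SUP_mono ennreal_leI norm_suminf_le_Sigma_c_norm
      simp: M_Sigma_def mult_space_def)

text \<open>Take suprema over \<open>n\<close> and over the unit ball in
  \<open>norm_partial_sum_le\<close>. Finiteness of both factors lets the real product be read back
  in \<open>ennreal\<close>.\<close>

lemma mult_norm_le_M_Sigma_norm:
  assumes f: "f \<in> M_Sigma smul V"
  shows "mult_norm smul V N Sigma_c_norm f \<le> nu V N * M_Sigma_norm smul V N f"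
proof -
  have "Sigma_c_norm (seq_mult smul v f) \<le> enn2real (nu V N) * p f"
    if v: "v \<in> V" "N v \<le> 1" for v
    unfolding Sigma_c_norm_def
  proof (rule cSUP_least)
    fix n
    have "enn2real (nu V N) * p f * N v \<le> enn2real (nu V N) * p f"
      using v by (intro mult_left_le) auto
    then show "norm (\<Sum>k\<le>n. seq_mult smul v f k) \<le> enn2real (nu V N) * p f"
      using norm_partial_sum_le[OF f \<open>v \<in> V\<close>] by (rule order_trans[rotated])
  qed simp
  then have "mult_norm smul V N Sigma_c_norm f \<le> ennreal (enn2real (nu V N) * p f)"
    unfolding mult_norm_def by (intro SUP_least ennreal_leI) auto
  also have "\<dots> = nu V N * M_Sigma_norm smul V N f"
    using finite_nu M_Sigma_norm_finite[OF f] by (simp add: ennreal_mult ennreal_enn2real)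
  finally show ?thesis .
qed

end

theorem theorem10p1:
  fixes smul :: "'k::real_normed_field \<Rightarrow> 'x::banach \<Rightarrow> 'x"
    and V :: "(nat \<Rightarrow> 'k) set"
    and N :: "(nat \<Rightarrow> 'k) \<Rightarrow> real"
  assumes X: "banach_space_over smul"
    and V: "BK_space (*) V N"
    and unit: "\<And>n. unit_seq n \<in> V"
    and finite_nu: "nu V N < \<infinity>"
  shows "(\<forall>f \<in> M_Sigma smul V. M_Sigma_norm smul V N f < \<infinity>) \<and>
    BK_space smul (M_Sigma smul V) (\<lambda>f. enn2real (M_Sigma_norm smul V N f)) \<and>
    (\<forall>f \<in> M_Sigma smul V.
      1 / nu V N * mult_norm smul V N Sigma_c_norm f \<le> M_Sigma_norm smul V N f \<and>
      M_Sigma_norm smul V N f \<le> mult_norm smul V N Sigma_c_norm f) \<and>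
    (nu V N = 1 \<longrightarrow>
      (\<forall>f \<in> M_Sigma smul V. M_Sigma_norm smul V N f = mult_norm smul V N Sigma_c_norm f))"
proof -
  interpret multiplier_space smul V N
    using X V unit finite_nu by (simp add: multiplier_space_def multiplier_space_axioms_def)
  have "1 / nu V N * mult_norm smul V N Sigma_c_norm f \<le> M_Sigma_norm smul V N f"
    if f: "f \<in> M_Sigma smul V" for f
  proof -
    have "1 / nu V N * mult_norm smul V N Sigma_c_norm f
        \<le> 1 / nu V N * (nu V N * M_Sigma_norm smul V N f)"
      by (intro mult_left_mono mult_norm_le_M_Sigma_norm f) simp
    also have "\<dots> \<le> M_Sigma_norm smul V N f"
    \<comment> \<open>Cancelling needs a nonzero finite factor. In the zero case the left side is 0
      by the convention that any extended real times 0 is 0, so no proof of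
      \<open>nu V N \<ge> 1\<close> is called for.\<close>
    proof (cases "nu V N = 0")
      case False
      then have "1 / nu V N * nu V N = 1"
        using finite_nu by (simp add: ennreal_divide_times)
      then show ?thesis
        by (simp flip: mult.assoc)
    qed simp
    finally show ?thesis .
  qed
  moreover have "M_Sigma_norm smul V N f = mult_norm smul V N Sigma_c_norm f"
    if "nu V N = 1" "f \<in> M_Sigma smul V" for f
    using M_Sigma_norm_le_mult_norm mult_norm_le_M_Sigma_norm that by (intro antisym) auto
  ultimately show ?thesis
    using M_Sigma_norm_finite BK_space_M_Sigma M_Sigma_norm_le_mult_norm by blast
qed

end
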